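(* Let $\mathbf K=(K_0,\dots,K_N)\in\mathbb Z_+^{N+1}$, $B\in\mathbb Z_+$ and $S\in(0,\frac{K_0}{L}]$ be given. Consider the problem of minimizing $C_A(\mathbf K,B,\mathbf\Gamma)$ over $\mathbf\Gamma=(\gamma^{(1)},\dots,\gamma^{(K_0)})\in\mathbb R^{K_0}$ subject to $0<\gamma^{(k_0)}\le\frac1L$ for all $k_0\in\mathcal K_0$ and $\sum_{k_0\in\mathcal K_0}\gamma^{(k_0)}=S$. Then an optimal solution of this problem is $\mathbf\Gamma=\frac{S}{K_0}\mathbf 1$, i.e. $\gamma^{(k_0)}=\frac S{K_0}$ for all $k_0\in\mathcal K_0$.
   Context: $N\in\mathbb Z_+$, $\mathcal N=\{1,\dots,N\}$, $\mathcal K_0=\{1,\dots,K_0\}$. $L$, $c_1,c_2,c_3,c_4$, and $q_{s_0,s_n}$ ($n\in\mathcal N$) are given positive constants, and $$C_A(\mathbf K,B,\mathbf\Gamma)=\frac{c_1}{\sum_{n\in\mathcal N}K_n\sum_{k_0\in\mathcal K_0}\gamma^{(k_0)}}+\frac{c_2\max_{n\in\mathcal N}K_n^2\sum_{k_0\in\mathcal K_0}(\gamma^{(k_0)})^3}{\sum_{k_0\in\mathcal K_0}\gamma^{(k_0)}}+\frac{c_3\sum_{k_0\in\mathcal K_0}(\gamma^{(k_0)})^2}{B\sum_{k_0\in\mathcal K_0}\gamma^{(k_0)}}+\frac{c_4\sum_{n\in\mathcal N}q_{s_0,s_n}K_n^2\sum_{k_0\in\mathcal K_0}(\gamma^{(k_0)})^2}{\sum_{n\in\mathcal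 N}K_n\sum_{k_0\in\mathcal K_0}\gamma^{(k_0)}}.$$ *)

theory Defs
  imports Complex_Main "HOL-Library.FuncSet"
begin

text \<open>
  The vector \<open>(K\<^sub>0, \<dots>, K\<^sub>N)\<close> is a function \<open>K\<close> of which only the values on \<open>{0..N}\<close> are used,
  and \<open>q n\<close> stands for \<open>q\<close> with subscripts \<open>s\<^sub>0, s\<^sub>n\<close>. The space of real vectors of length \<open>K\<^sub>0\<close>
  is \<open>{1..K 0} \<rightarrow>\<^sub>E UNIV\<close>: functions on the index set with a fixed dummy value outside it,
  so that they correspond one-to-one to tuples.
\<close>

definition C_A ::
  "real \<Rightarrow> real \<Rightarrow> real \<Rightarrow> real \<Rightarrow> (nat \<Rightarrow> real) \<Rightarrow> nat \<Rightarrow>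
   (nat \<Rightarrow> nat) \<Rightarrow> nat \<Rightarrow> (nat \<Rightarrow> real) \<Rightarrow> real" where
  "C_A c1 c2 c3 c4 q N K B \<Gamma> =
     c1 / ((\<Sum>n\<in>{1..N}. real (K n)) * (\<Sum>k\<in>{1..K 0}. \<Gamma> k))
   + c2 * (MAX n\<in>{1..N}. (real (K n))^2) * (\<Sum>k\<in>{1..K 0}. (\<Gamma> k)^3) / (\<Sum>k\<in>{1..K 0}. \<Gamma> k)
   + c3 * (\<Sum>k\<in>{1..K 0}. (\<Gamma> k)^2) / (real B * (\<Sum>k\<in>{1..K 0}. \<Gamma> k))
   + c4 * (\<Sum>n\<in>{1..N}. q n * (real (K n))^2) * (\<Sum>k\<in>{1..K 0}. (\<Gamma> k)^2)
       / ((\<Sum>n\<in>{1..N}. real (K n)) * (\<Sum>k\<in>{1..K 0}. \<Gamma> k))"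

definition feasible :: "real \<Rightarrow> nat \<Rightarrow> real \<Rightarrow> (nat \<Rightarrow> real) \<Rightarrow> bool" where
  "feasible L K0 S \<Gamma> \<longleftrightarrow>
     \<Gamma> \<in> {1..K0} \<rightarrow>\<^sub>E UNIV \<and>
     (\<forall>k\<in>{1..K0}. 0 < \<Gamma> k \<and> \<Gamma> k \<le> 1 / L) \<and>
     (\<Sum>k\<in>{1..K0}. \<Gamma> k) = S"

end

theory Submission
  imports Defs
begin

text \<open>
  On the feasible set the sum of the step sizes is the constant \<open>S\<close>, so \<open>C_A\<close> is a
  nondecreasing function of the sums of squares and of cubes. By the power mean inequality both
  are smallest at the constant vector.
\<close>

text \<open>Bernoulli's inequality, rescaled, is the tangent line bound at the mean; summing it
  cancels the linear terms.\<close>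

lemma power_mean_le_sum_power:
  fixes f :: "'a \<Rightarrow> real"
  assumes nonneg: "\<And>x. x \<in> A \<Longrightarrow> 0 \<le> f x" and pos: "0 < sum f A"
  shows "real (card A) * (sum f A / real (card A)) ^ p \<le> (\<Sum>x\<in>A. f x ^ p)"
proof -
  define a where "a = sum f A / real (card A)"
  \<comment> \<open>By convention \<open>sum\<close> is 0 on an infinite set, as it is on the empty
    set, so a positive sum excludes both.\<close>
  have "finite A" "A \<noteq> {}"
    using pos by (auto intro: ccontr)
  then have card: "real (card A) > 0"
    by (simp add: card_gt_0_iff)
  with pos have a: "a > 0"
    by (simp add: a_def)
  have tangent: "a ^ p * (1 + real p * (f x / a - 1)) \<le> f x ^ p" if "x \<in> A" for x
  proof -
    \<comment> \<open>Bernoulli's inequality needs an increment of at least -1; for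
      \<open>f x / a - 1\<close> this is the nonnegativity of \<open>f x\<close>.\<close>
    have "1 + real p * (f x / a - 1) \<le> (1 + (f x / a - 1)) ^ p"
      using nonneg[OF that] a by (intro Bernoulli_inequality) simp
    then have "a ^ p * (1 + real p * (f x / a - 1)) \<le> a ^ p * (f x / a) ^ p"
      using a by (intro mult_left_mono) auto
    also have "\<dots> = f x ^ p"
      using a by (simp add: power_divide)
    finally show ?thesis .
  qed
  have "(\<Sum>x\<in>A. f x / a - 1) = 0"
    using card pos
    by (simp add: sum_subtractf a_def flip: sum_divide_distrib sum_distrib_right)
  then have "real (card A) * a ^ p = (\<Sum>x\<in>A. a ^ p * (1 + real p * (f x / a - 1)))"
    by (simp add: sum.distrib flip: sum_distrib_left)
  also have "\<dots> \<le> (\<Sum>x\<in>A. f x ^ p)"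
    by (intro sum_mono tangent)
  finally show ?thesis
    by (simp add: a_def)
qed

theorem lemma4:
  fixes N B :: nat and K :: "nat \<Rightarrow> nat" and q :: "nat \<Rightarrow> real"
    and L S c1 c2 c3 c4 :: real
  assumes "N > 0"
    and "L > 0" and "c1 > 0" and "c2 > 0" and "c3 > 0" and "c4 > 0"
    and "\<forall>n\<in>{1..N}. q n > 0"
    and "\<forall>n\<in>{0..N}. K n > 0" and "B > 0"
    and "S \<in> {0<..real (K 0) / L}"
  shows "is_arg_min (C_A c1 c2 c3 c4 q N K B) (feasible L (K 0) S)
           (\<lambda>k\<in>{1..K 0}. S / real (K 0))"
proof -
  let ?\<Gamma> = "\<lambda>k\<in>{1..K 0}. S / real (K 0)"
  have K0: "real (K 0) > 0" and S: "S > 0" "S \<le> real (K 0) / L"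
    using assms by auto
  have sum_const: "(\<Sum>k\<in>{1..K 0}. ?\<Gamma> k) = S"
    using K0 by simp
  \<comment> \<open>The upper bound on \<open>S\<close> is what keeps the mean within the step size
    limit.\<close>
  have "S / real (K 0) \<le> 1 / L"
    using S K0 by (simp add: divide_le_eq mult.commute)
  then have feasible: "feasible L (K 0) S ?\<Gamma>"
    using S K0 sum_const by (auto simp: feasible_def)
  \<comment> \<open>Monotonicity in the power sums needs nonnegative coefficients.
    \<open>N > 0\<close> makes the set under \<open>MAX\<close> nonempty.\<close>
  have max_nonneg: "0 \<le> (MAX n\<in>{1..N}. (real (K n))\<^sup>2)"
    using \<open>N > 0\<close> by (subst Max_ge_iff) auto
  have q_nonneg: "0 \<le> (\<Sum>n\<in>{1..N}. q n * (real (K n))\<^sup>2)"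
    using assms by (intro sum_nonneg) (simp add: less_imp_le)
  have "C_A c1 c2 c3 c4 q N K B ?\<Gamma> \<le> C_A c1 c2 c3 c4 q N K B \<Gamma>"
    if \<Gamma>: "feasible L (K 0) S \<Gamma>" for \<Gamma>
  proof -
    have sum: "(\<Sum>k\<in>{1..K 0}. \<Gamma> k) = S"
      using \<Gamma> by (simp add: feasible_def)
    \<comment> \<open>Every feasible \<Gamma> has mean \<open>S / real (K 0)\<close>, so the power
      mean bound is attained by the constant vector.\<close>
    have pow: "(\<Sum>k\<in>{1..K 0}. ?\<Gamma> k ^ p) \<le> (\<Sum>k\<in>{1..K 0}. \<Gamma> k ^ p)" for p
      using power_mean_le_sum_power[of "{1..K 0}" \<Gamma> p] \<Gamma> S sum
      by (auto simp: feasible_def less_imp_le)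
    \<comment> \<open>With both sums rewritten to \<open>S\<close>, the denominators agree and the
      first summands coincide; the others compare by \<open>pow\<close> with exponents 3 and
      2.\<close>
    show ?thesis
      unfolding C_A_def sum sum_const
      using assms S max_nonneg q_nonneg
      by (intro add_mono divide_right_mono mult_left_mono pow)
        (auto intro!: mult_nonneg_nonneg sum_nonneg simp: less_imp_le)
  qed
  with feasible show ?thesis
    by (auto simp: is_arg_min_def not_less)
qed

end
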